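(* Let $q$ be a prime power, let $n$ be a positive integer, let $s$ be an integer with $\gcd(s,2n)=1$, and let $\gamma\in\mathbb F_{q^{2n}}$ be such that $N_{q^{2n}/q}(\gamma)$ is a non-square in $\mathbb F_q$. Then $\gamma\notin\mathbb F_{q^n}$, so every $x\in\mathbb F_{q^{2n}}$ can be written as $x=c+d\gamma$ with $c,d\in\mathbb F_{q^n}$. Write $\gamma^{q^s+1}=u+v\gamma$ with $u,v\in\mathbb F_{q^n}$. Then for all $a,b,c,d\in\mathbb F_{q^n}$ and $x=c+d\gamma$, $$ax+\gamma bx^{q^s}=(ac+bd^{q^s}u)+(ad+bc^{q^s}+bd^{q^s}v)\gamma,$$ and the corresponding multiplication on $\mathbb F_{q^n}^2$, $$(c,d)*(a,b)=(ac+bd^{q^s}u,\ ad+bc^{q^s}+bd^{q^s}v),$$ is a semifield multiplication which is exactly the multiplication of a Hughes--Kleinfeld semifield. (That is, the semifield corresponding to the MRD code $\{aX+\gamma bX^{q^s}:a,b\in\mathbb F_{q^n}\}$ of minimum distance $2n$ in $\mathbb F_q^{2n\times 2n}$ is a Hughes--Kleinfeld semifield.)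
   Context: $N_{q^{2n}/q}$ is the norm from $\mathbb F_{q^{2n}}$ to $\mathbb F_q$. A (finite) semifield is a finite algebraic structure $(\mathbb S,+,* )$ satisfying all the axioms of a skewfield except possibly associativity of multiplication. A Hughes--Kleinfeld semifield (also called a Knuth semifield of type II) over a finite field $F$ is $F^2$ with componentwise addition and multiplication $(c,d)*(a,b)=(ac+bd^{\sigma}u,\ ad+bc^{\sigma}+bd^{\sigma}v)$, where $\sigma$ is an automorphism of $F$ and $u,v\in F$ are such that $w^{\sigma}w+vw-u=0$ has no solution $w\in F$. Elements $aX+\gamma bX^{q^s}$ are identified with $\mathbb F_q$-linear maps of $\mathbb F_{q^{2n}}$. *)

theory Defs
  imports
    "HOL-Number_Theory.Prime_Powers"
    "HOL-Algebra.QuotRing"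
    "HOL-Algebra.Embedded_Algebras"
    "HOL-Algebra.Algebraic_Closure_Type"
begin

text \<open>
  The big finite field is a type of class finite and field.  Subfields, automorphisms, dimensions and
  semifields are HOL-Algebra notions; \<^const>\<open>ring_of_type_algebra\<close> is the library's passage
  from the type to its HOL-Algebra record.
\<close>

subsection \<open>Finite fields\<close>

text \<open>
  When the type has \<open>m ^ k\<close> elements (\<open>k > 0\<close>, \<open>m\<close> a prime power) this is its unique subfield of
  order \<open>m\<close>.
\<close>
definition GF :: "nat \<Rightarrow> 'a::field set" where
  "GF m = {x. x ^ m = x}"

definition GF_ring :: "nat \<Rightarrow> 'a::field ring" where
  "GF_ring m = ring_of_type_algebra\<lparr>carrier := GF m\<rparr>"

text \<open>The norm from the field of order \<open>q ^ m\<close> to its subfield of order \<open>q\<close>.\<close>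
definition field_norm :: "nat \<Rightarrow> nat \<Rightarrow> 'a::field \<Rightarrow> 'a" where
  "field_norm q m x = (\<Prod>i<m. x ^ (q ^ i))"

text \<open>
  The value of \<open>x\<close> raised to \<open>q\<^sup>s\<close> for an integer \<open>s\<close>: a negative \<open>s\<close> denotes the inverse of the
  corresponding (bijective) Frobenius power.
\<close>
definition frob :: "nat \<Rightarrow> int \<Rightarrow> 'a::field \<Rightarrow> 'a" where
  "frob q s x =
     (if s \<ge> 0 then x ^ (q ^ nat s) else inv_into UNIV (\<lambda>y. y ^ (q ^ nat (- s))) x)"

subsection \<open>Semifields\<close>

text \<open>
  In the absence of associativity, the invertibility axiom of a skewfield is unique left and
  right division by nonzero elements.
\<close>
locale semifield = abelian_group S for S (structure) +
  assumes mult_closed: "\<lbrakk>x \<in> carrier S; y \<in> carrier S\<rbrakk> \<Longrightarrow> x \<otimes> y \<in> carrier S"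
    and unit_closed: "\<one> \<in> carrier S"
    and unit_left: "x \<in> carrier S \<Longrightarrow> \<one> \<otimes> x = x"
    and unit_right: "x \<in> carrier S \<Longrightarrow> x \<otimes> \<one> = x"
    and unit_nonzero: "\<one> \<noteq> \<zero>"
    and distr_right: "\<lbrakk>x \<in> carrier S; y \<in> carrier S; z \<in> carrier S\<rbrakk>
          \<Longrightarrow> (x \<oplus> y) \<otimes> z = x \<otimes> z \<oplus> y \<otimes> z"
    and distr_left: "\<lbrakk>x \<in> carrier S; y \<in> carrier S; z \<in> carrier S\<rbrakk>
          \<Longrightarrow> z \<otimes> (x \<oplus> y) = z \<otimes> x \<oplus> z \<otimes> y"
    and left_division: "\<lbrakk>a \<in> carrier S; a \<noteq> \<zero>; b \<in> carrier S\<rbrakk>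
          \<Longrightarrow> \<exists>!x. x \<in> carrier S \<and> a \<otimes> x = b"
    and right_division: "\<lbrakk>a \<in> carrier S; a \<noteq> \<zero>; b \<in> carrier S\<rbrakk>
          \<Longrightarrow> \<exists>!x. x \<in> carrier S \<and> x \<otimes> a = b"

text \<open>
  \<open>S\<close> is the Hughes--Kleinfeld semifield over the finite field \<open>F\<close> with data \<open>\<sigma>\<close>, \<open>u\<close>, \<open>v\<close>.  That \<open>S\<close>
  satisfies the axioms of a semifield is not assumed here.
\<close>
locale hughes_kleinfeld = F?: field F
  for F :: "'a ring" (structure) and \<sigma> :: "'a \<Rightarrow> 'a" and u v :: 'a and S :: "('a \<times> 'a) ring" +
  assumes finite_base: "finite (carrier F)"
    and automorphism: "\<sigma> \<in> ring_iso F F"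
    and u_closed: "u \<in> carrier F"
    and v_closed: "v \<in> carrier F"
    and no_root: "\<not> (\<exists>w \<in> carrier F. ((\<sigma> w \<otimes> w) \<oplus> (v \<otimes> w)) \<ominus> u = \<zero>)"
    and carrier_S: "carrier S = carrier F \<times> carrier F"
    and zero_S: "\<zero>\<^bsub>S\<^esub> = (\<zero>, \<zero>)"
    and one_S: "\<one>\<^bsub>S\<^esub> = (\<one>, \<zero>)"
    and add_S: "\<lbrakk>a \<in> carrier F; b \<in> carrier F; c \<in> carrier F; d \<in> carrier F\<rbrakk>
          \<Longrightarrow> (c, d) \<oplus>\<^bsub>S\<^esub> (a, b) = (c \<oplus> a, d \<oplus> b)"
    and mult_S: "\<lbrakk>a \<in> carrier F; b \<in> carrier F; c \<in> carrier F; d \<in> carrier F\<rbrakk>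
          \<Longrightarrow> (c, d) \<otimes>\<^bsub>S\<^esub> (a, b) =
                (a \<otimes> c \<oplus> b \<otimes> \<sigma> d \<otimes> u, a \<otimes> d \<oplus> b \<otimes> \<sigma> c \<oplus> b \<otimes> \<sigma> d \<otimes> v)"

subsection \<open>Rank metric codes\<close>

text \<open>
  A field of order \<open>q ^ m\<close> is an \<open>m\<close>-dimensional space over its subfield of order \<open>q\<close>, so \<open>m \<times> m\<close> matrices
  over that subfield are identified with its linear endomorphisms.
\<close>
definition gf_linear :: "nat \<Rightarrow> ('a::field \<Rightarrow> 'a) \<Rightarrow> bool" where
  "gf_linear q f \<longleftrightarrow>
     (\<forall>x y. f (x + y) = f x + f y) \<and> (\<forall>k \<in> GF q. \<forall>x. f (k * x) = k * f x)"

definition gf_rank :: "nat \<Rightarrow> ('a::field \<Rightarrow> 'a) \<Rightarrow> nat" where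
  "gf_rank q f = (THE r. ring.dimension (ring_of_type_algebra :: 'a ring) r (GF q) (range f))"

definition min_rank_distance :: "nat \<Rightarrow> ('a::{field,finite} \<Rightarrow> 'a) set \<Rightarrow> nat" where
  "min_rank_distance q C = Min {gf_rank q (\<lambda>x. f x - g x) | f g. f \<in> C \<and> g \<in> C \<and> f \<noteq> g}"

text \<open>Codes of square matrices of size \<open>m\<close> and minimum distance \<open>d\<close> attaining the Singleton bound.\<close>
definition mrd_code :: "nat \<Rightarrow> nat \<Rightarrow> nat \<Rightarrow> ('a::{field,finite} \<Rightarrow> 'a) set \<Rightarrow> bool" where
  "mrd_code q m d C \<longleftrightarrow>
     (\<forall>f \<in> C. gf_linear q f) \<and> (\<exists>f \<in> C. \<exists>g \<in> C. f \<noteq> g) \<and>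
     min_rank_distance q C = d \<and> card C = q ^ (m * (m - d + 1))"

definition twisted_code :: "nat \<Rightarrow> nat \<Rightarrow> int \<Rightarrow> 'a::field \<Rightarrow> ('a \<Rightarrow> 'a) set" where
  "twisted_code q n s \<gamma> =
     {(\<lambda>x. a * x + \<gamma> * b * frob q s x) | a b. a \<in> GF (q ^ n) \<and> b \<in> GF (q ^ n)}"

text \<open>
  The elements of \<open>C\<close> are, in additive coordinates, the right multiplications of \<open>S\<close>.  This
  determines \<open>S\<close> from \<open>C\<close> up to isotopism.
\<close>
definition corresponds_to_code :: "'b ring \<Rightarrow> ('a::field \<Rightarrow> 'a) set \<Rightarrow> bool" where
  "corresponds_to_code S C \<longleftrightarrow>
     (\<exists>\<phi> \<psi>. bij_betw \<phi> (carrier S) UNIV \<and> bij_betw \<psi> (carrier S) C \<and>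
        (\<forall>x \<in> carrier S. \<forall>y \<in> carrier S.
           \<phi> (x \<oplus>\<^bsub>S\<^esub> y) = \<phi> x + \<phi> y \<and>
           (\<forall>z. \<psi> (x \<oplus>\<^bsub>S\<^esub> y) z = \<psi> x z + \<psi> y z) \<and>
           \<phi> (x \<otimes>\<^bsub>S\<^esub> y) = \<psi> y (\<phi> x)))"

end

theory Submission
  imports Defs "HOL-Number_Theory.Residues" "HOL-Library.Product_Plus"
begin

text \<open>
  Write \<open>K\<close> for the field of order \<open>q\<^sup>2\<^sup>n\<close>, \<open>F\<close> for its subfield of order \<open>q\<^sup>n\<close>, \<open>N\<close> for the norm
  from \<open>K\<close> to the field of order \<open>q\<close>, and \<open>\<sigma>\<close> for the given power of the Frobenius automorphism.
  On \<open>F\<close> the norm \<open>N\<close> is the square of the norm from \<open>F\<close> to the field of order \<open>q\<close>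
  (\<open>field_norm_double\<close>), so it takes only square values there, whereas \<open>N \<gamma>\<close> is a non-square.
  Hence \<open>\<gamma> \<notin> F\<close>, and \<open>coord (c, d) = c + d \<gamma>\<close> is a bijection from \<open>F \<times> F\<close> to \<open>K\<close>, because it is
  injective and both sides have the same number of elements.

  The norm also decides everything else.  If \<open>a x + \<gamma> b \<sigma> x = 0\<close> with \<open>a, b \<in> F\<close>, \<open>b \<noteq> 0\<close> and \<open>x \<noteq> 0\<close>,
  then \<open>\<gamma> \<sigma> x = y x\<close> for some \<open>y \<in> F\<close>, and \<open>N (\<sigma> x) = N x\<close> gives \<open>N \<gamma> = N y\<close>, which is a square.
  So a nonzero map \<open>x \<mapsto> a x + \<gamma> b \<sigma> x\<close> has trivial kernel (\<open>twist_eq_0_iff\<close>).  Three consequences: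

  \<^item> Every difference of distinct codewords is bijective, so the minimum distance is \<open>2 n\<close>; the
    \<open>q\<^sup>2\<^sup>n\<close> codewords are then as many as the Singleton bound allows.

  \<^item> The expression \<open>a x + \<gamma> b \<sigma> x\<close> is additive both in \<open>x\<close> and in the pair \<open>(a, b)\<close>, and it vanishes only if
    \<open>x = 0\<close> or \<open>(a, b) = 0\<close>.  By finiteness it can be solved uniquely for either argument.  Expanding it
    with \<open>\<sigma> \<gamma> \<gamma> = u + v \<gamma>\<close> shows that it is the product of the theorem in the coordinates \<open>coord\<close>
    (\<open>coord_mult\<close>), which is therefore a semifield product.

  \<^item> A root \<open>w \<in> F\<close> of \<open>\<sigma> w w + v w - u\<close> would make \<open>w + \<gamma> \<noteq> 0\<close> a zero of the map with
    \<open>a = - (v + \<sigma> w)\<close> and \<open>b = 1\<close>.  So there is none, as the definition of a Hughes--Kleinfeld semifield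
    requires (\<open>no_root\<close>).
\<close>

section \<open>Finite fields and their subfields\<close>

lemma power_card_eq_same:
  fixes x :: "'a :: {field, finite}"
  shows "x ^ card (UNIV :: 'a set) = x"
proof (cases "x = 0")
  case False
  have pos: "card (UNIV :: 'a set) > 0"
    by (simp add: finite_UNIV_card_ge_0)
  have "(\<Prod>y\<in>UNIV-{0}. x * y) = (\<Prod>y\<in>UNIV-{0}. y)"
    by (rule prod.reindex_bij_witness[of _ "\<lambda>y. y / x" "\<lambda>y. x * y"]) (use False in auto)
  moreover have "(\<Prod>y\<in>UNIV-{0}. x * y) = x ^ (card (UNIV :: 'a set) - 1) * (\<Prod>y\<in>UNIV-{0}. y)"
    by (simp add: prod.distrib)
  ultimately have "x ^ (card (UNIV :: 'a set) - 1) = 1"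
    by simp
  then show ?thesis
    using pos by (metis Suc_diff_1 mult.right_neutral power_Suc)
qed (use finite_UNIV_card_ge_0[where ?'a = 'a] in auto)

lemma add_power_primepow:
  fixes x y :: "'a :: {field, finite}"
  assumes "primepow q" and "card (UNIV :: 'a set) = q ^ m"
  shows "(x + y) ^ (q ^ k) = x ^ (q ^ k) + y ^ (q ^ k)"
proof -
  obtain p e where p: "normalization_semidom_class.prime p" and q: "q = p ^ e"
    using assms(1) by (auto simp: primepow_def)
  have char: "normalization_semidom_class.prime CHAR('a)"
    by (rule prime_CHAR_semidom) (simp add: finite_imp_CHAR_pos)
  have "CHAR('a) dvd p ^ (e * m)"
    using CHAR_dvd_CARD[where ?'a = 'a] assms(2) q by (simp add: power_mult)
  then have "CHAR('a) = p"
    using char p by (meson prime_dvd_power primes_dvd_imp_eq)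
  then have "q ^ k = CHAR('a) ^ (e * k)"
    using q by (simp add: power_mult)
  then show ?thesis
    by (intro freshmans_dream' char)
qed

lemma card_power_eq_one_le:
  fixes k :: nat
  assumes "k > 0"
  shows "card {x :: 'a :: {field, finite}. x ^ k = 1} \<le> k"
proof -
  define p :: "'a poly" where "p = monom 1 k - 1"
  have "coeff p 0 = -1"
    using assms by (simp add: p_def)
  then have "p \<noteq> 0"
    by auto
  have "degree p \<le> k"
    unfolding p_def by (intro degree_diff_le degree_monom_le) simp
  moreover have "poly p x = x ^ k - 1" for x
    by (simp add: p_def poly_monom)
  ultimately show ?thesis
    using card_poly_roots_bound[OF \<open>p \<noteq> 0\<close>] by simp
qed

text \<open>
  For \<open>Q = 1 + j k\<close>, the polynomial \<open>X\<^sup>Q - X\<close> factors as \<open>X (X\<^sup>j - 1) \<Sum>\<^sub>i\<^sub><\<^sub>k X\<^sup>j\<^sup>i\<close>.  Bounding the number of roots of the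
  last factor from above bounds that of \<open>X\<^sup>j - 1\<close> from below in a field of order \<open>Q\<close>.
\<close>
lemma card_geometric_roots_le:
  fixes j k :: nat
  assumes "j > 0" and "k > 0"
  shows "card {x :: 'a :: {field, finite}. (\<Sum>i<k. (x ^ j) ^ i) = 0} \<le> j * (k - 1)"
proof -
  define r :: "'a poly" where "r = (\<Sum>i<k. monom 1 (j * i))"
  have "coeff r 0 = (\<Sum>i<k. if i = 0 then 1 else 0)"
    using assms unfolding r_def coeff_sum by (intro sum.cong) auto
  also have "\<dots> = 1"
    using assms by simp
  finally have "r \<noteq> 0"
    by auto
  have "degree r \<le> j * (k - 1)"
    unfolding r_def
    by (rule degree_sum_le) (use assms in \<open>auto simp: degree_monom_eq\<close>)
  moreover have "poly r x = (\<Sum>i<k. (x ^ j) ^ i)" for x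
    by (simp add: r_def poly_sum poly_monom power_mult)
  ultimately show ?thesis
    using card_poly_roots_bound[OF \<open>r \<noteq> 0\<close>] by simp
qed

text \<open>
  All \<open>q\<^sup>d\<^sup>e\<close> elements of the field are roots of a polynomial of that degree, so each of its factors,
  among them \<open>X\<^sup>m - X\<close> with \<open>m = q\<^sup>d\<close>, has as many roots as its degree allows.
\<close>
lemma card_GF:
  assumes card: "card (UNIV :: 'a :: {field, finite} set) = q ^ (d * e)"
    and "q > 1" and "d > 0" and "e > 0"
  shows "card (GF (q ^ d) :: 'a set) = q ^ d"
proof -
  define j where "j = q ^ d - 1"
  define k where "k = (\<Sum>i<e. (q ^ d) ^ i)"
  have qd: "q ^ d > 1"
    using assms(2,3) by (rule one_less_power)
  have j: "j > 0" "q ^ d = Suc j"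
    using qd by (auto simp: j_def)
  have "(q ^ d) ^ e - 1 = j * k"
    using power_diff_1_eq[of "int (q ^ d)" e] qd
    by (simp add: j_def k_def of_nat_diff flip: int_int_eq)
  then have jk: "card (UNIV :: 'a set) = Suc (j * k)"
    using card qd by (metis Suc_diff_1 assms(2) power_mult zero_less_power not_gr_zero not_one_less_zero)
  have k: "k > 0"
    unfolding k_def using assms by (intro sum_pos) auto
  let ?A = "{x :: 'a. x ^ j = 1}"
  let ?B = "{x :: 'a. (\<Sum>i<k. (x ^ j) ^ i) = 0}"
  have GF: "GF (q ^ d) = insert 0 ?A"
    using j by (auto simp: GF_def)
  have "x = 0 \<or> x ^ j = 1 \<or> (\<Sum>i<k. (x ^ j) ^ i) = 0" for x :: 'a
  proof -
    have "x * (x ^ (j * k) - 1) = 0"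
      using power_card_eq_same[of x] jk by (simp add: algebra_simps)
    then show ?thesis
      using power_diff_1_eq[of "x ^ j" k] by (auto simp: power_mult)
  qed
  then have "UNIV = insert 0 (?A \<union> ?B)"
    by auto
  then have "Suc (j * k) = card (insert 0 (?A \<union> ?B))"
    using jk by simp
  also have "\<dots> \<le> Suc (card ?A + card ?B)"
    by (metis (no_types, lifting) card_Un_le card_insert_le_m1 card_insert_if finite Suc_le_mono le_SucI)
  also have "\<dots> \<le> Suc (card ?A + j * (k - 1))"
    using card_geometric_roots_le[OF j(1) k, where ?'a = 'a] by simp
  finally have "j \<le> card ?A"
    using k by (cases k) auto
  with card_power_eq_one_le[OF j(1), where ?'a = 'a] have "card ?A = j"
    by simp
  then have "card (insert 0 ?A) = Suc j"
    using j(1) by (simp add: power_0_left)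
  then show ?thesis
    using GF j(2) by metis
qed

lemma ring_of_type_algebra_simps [simp]:
  "carrier ring_of_type_algebra = UNIV"
  "x \<otimes>\<^bsub>ring_of_type_algebra\<^esub> y = x * y"
  "\<one>\<^bsub>ring_of_type_algebra\<^esub> = 1"
  "\<zero>\<^bsub>ring_of_type_algebra\<^esub> = 0"
  "x \<oplus>\<^bsub>ring_of_type_algebra\<^esub> y = x + y"
  by (simp_all add: ring_of_type_algebra_def)

lemma ring_of_type_algebra_uminus [simp]:
  fixes x :: "'a :: field"
  shows "\<ominus>\<^bsub>ring_of_type_algebra\<^esub> x = - x"
proof -
  interpret R: field "ring_of_type_algebra :: 'a ring"
    by (rule field_from_type_algebra)
  show ?thesis
    by (rule R.minus_equality) auto
qed

lemma
  fixes x y :: "'a :: field"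
  shows GF_mult: "x \<in> GF m \<Longrightarrow> y \<in> GF m \<Longrightarrow> x * y \<in> GF m"
    and GF_one: "1 \<in> GF m"
    and GF_inverse: "x \<in> GF m \<Longrightarrow> inverse x \<in> GF m"
  by (auto simp: GF_def power_mult_distrib power_inverse)

text \<open>
  The type token is a parameter because neither \<open>q\<close> nor \<open>m\<close> mentions the type of the field.
\<close>
locale primepow_field =
  fixes q m :: nat and ty :: "'a :: {field, finite} itself"
  assumes primepow: "primepow q"
    and card_field: "card (UNIV :: 'a set) = q ^ m"
begin

lemma q_gt_1: "q > 1"
  using primepow by (rule primepow_gt_Suc_0[unfolded One_nat_def[symmetric]])

lemma frobenius_add: "((x :: 'a) + y) ^ (q ^ k) = x ^ (q ^ k) + y ^ (q ^ k)"
  using add_power_primepow[OF primepow card_field] .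

lemma GF_zero: "(0 :: 'a) \<in> GF (q ^ k)"
  using q_gt_1 by (simp add: GF_def)

lemma GF_add: "(x :: 'a) \<in> GF (q ^ k) \<Longrightarrow> y \<in> GF (q ^ k) \<Longrightarrow> x + y \<in> GF (q ^ k)"
  by (simp add: GF_def frobenius_add)

text \<open>Deducing the sign from additivity avoids a case distinction on the parity of \<open>q\<close>.\<close>
lemma GF_uminus:
  assumes "(x :: 'a) \<in> GF (q ^ k)"
  shows "- x \<in> GF (q ^ k)"
proof -
  have "x ^ (q ^ k) + (- x) ^ (q ^ k) = (0 :: 'a)"
    using frobenius_add[of x "- x" k] q_gt_1 by (simp add: power_0_left)
  then show ?thesis
    using assms by (simp add: GF_def add_eq_0_iff)
qed

lemma GF_diff: "(x :: 'a) \<in> GF (q ^ k) \<Longrightarrow> y \<in> GF (q ^ k) \<Longrightarrow> x - y \<in> GF (q ^ k)"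
  using GF_add GF_uminus by (metis diff_conv_add_uminus)

lemma subfield_GF: "subfield (GF (q ^ k)) (ring_of_type_algebra :: 'a ring)"
proof -
  interpret R: field "ring_of_type_algebra :: 'a ring"
    by (rule field_from_type_algebra)
  have inv: "inv\<^bsub>ring_of_type_algebra\<^esub> x = inverse x" if "x \<noteq> 0" for x :: 'a
    by (rule R.comm_inv_char) (use that in auto)
  show ?thesis
    by (rule R.subfieldI'[OF R.subringI])
      (auto simp: inv GF_mult GF_one GF_inverse GF_add GF_uminus)
qed

lemma field_GF_ring: "field (GF_ring (q ^ k) :: 'a ring)"
proof -
  interpret R: field "ring_of_type_algebra :: 'a ring"
    by (rule field_from_type_algebra)
  show ?thesis
    unfolding GF_ring_def by (rule R.subfield_iff(2)[OF subfield_GF])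
qed

end

text \<open>
  The rank of a code word is defined through the dimension over a subfield, which counting
  elements determines in a finite field.
\<close>
lemma card_eq_power_dimension:
  fixes K E :: "'a :: {field, finite} set"
  assumes K: "subfield K (ring_of_type_algebra :: 'a ring)"
    and dim: "ring.dimension (ring_of_type_algebra :: 'a ring) r K E"
  shows "card E = card K ^ r"
proof -
  interpret R: field "ring_of_type_algebra :: 'a ring"
    by (rule field_from_type_algebra)
  from dim K show ?thesis
  proof (induction r K E rule: R.dimension.induct)
    case (zero_dim K)
    then show ?case by simp
  next
    case (Suc_dim v E r K)
    note E = R.space_subgroup_props[OF Suc_dim.prems Suc_dim.hyps(3)]
    have E_diff: "x - y \<in> E" if "x \<in> E" "y \<in> E" for x y
      using E(3)[OF that(1) E(4)[OF that(2)]] by simp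
    have K_diff: "x - y \<in> K" if "x \<in> K" "y \<in> K" for x y
      using subringE(7)[OF subfieldE(1)[OF Suc_dim.prems] that(1)]
        subringE(5)[OF subfieldE(1)[OF Suc_dim.prems] that(2)]
      by fastforce
    have ext: "R.line_extension K v E = (\<lambda>(k, w). k * v + w) ` (K \<times> E)"
      by (auto simp: R.line_extension_mem_iff; blast)
    have "inj_on (\<lambda>(k, w). k * v + w) (K \<times> E)"
    proof (rule inj_onI, clarify)
      fix k w k' w'
      assume *: "k \<in> K" "w \<in> E" "k' \<in> K" "w' \<in> E" "k * v + w = k' * v + w'"
      have "(k - k') * v = w' - w"
        using *(5) by (simp add: algebra_simps)
      then have "(k - k') * v \<in> E"
        using E_diff * by simp
      then have "k = k'"
        using E(6)[of "k - k'" v] K_diff * Suc_dim.hyps(2) by fastforce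
      then show "k = k' \<and> w = w'"
        using * by simp
    qed
    then show ?case
      using Suc_dim.IH[OF Suc_dim.prems] by (simp add: ext card_image card_cartesian_product)
  qed
qed

lemma gf_rank_surj:
  fixes f :: "'a :: {field, finite} \<Rightarrow> 'a"
  assumes "primepow q" and card: "card (UNIV :: 'a set) = q ^ m" and "m > 0" and "surj f"
  shows "gf_rank q f = m"
proof -
  interpret primepow_field q m "TYPE('a)"
    by standard (use assms in auto)
  interpret R: field "ring_of_type_algebra :: 'a ring"
    by (rule field_from_type_algebra)
  have K: "subfield (GF q) (ring_of_type_algebra :: 'a ring)"
    using subfield_GF[of 1] by simp
  have cardK: "card (GF q :: 'a set) = q"
    using card_GF[of q 1 m, where ?'a = 'a] card \<open>m > 0\<close> q_gt_1 by simp
  obtain Us :: "'a list" where Us: "set Us = UNIV"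
    using finite_list[OF finite_UNIV] by blast
  have "R.Span (GF q) Us = UNIV"
    using R.Span_base_incl[OF K, of Us] Us by auto
  then obtain r where r: "R.dimension r (GF q) UNIV"
    using R.Span_finite_dimension[OF K, of Us] by (auto simp: R.finite_dimension_def)
  have "q ^ m = q ^ r"
    using card_eq_power_dimension[OF K r] card cardK by simp
  then have "r = m"
    using q_gt_1 by (simp add: power_inject_exp)
  with r have "R.dimension m (GF q) UNIV"
    by simp
  then show ?thesis
    unfolding gf_rank_def \<open>surj f\<close> by (intro the_equality) (auto dest: R.dimension_is_inj[OF K])
qed

section \<open>Integral powers of the Frobenius automorphism\<close>

context primepow_field
begin

lemma frobenius_power_bij: "bij (\<lambda>x :: 'a. x ^ (q ^ k))"
proof -
  have "inj (\<lambda>x :: 'a. x ^ (q ^ k))"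
  proof (rule injI)
    fix x y :: 'a
    assume "x ^ (q ^ k) = y ^ (q ^ k)"
    then have "(x - y) ^ (q ^ k) = 0"
      using frobenius_add[of "x - y" y k] by simp
    then show "x = y"
      by simp
  qed
  then show ?thesis
    by (simp add: bij_def finite_UNIV_inj_surj)
qed

lemma GF_frobenius_power: "(x :: 'a) \<in> GF q \<Longrightarrow> x ^ (q ^ k) = x"
  by (induction k) (simp_all add: GF_def power_mult)

lemma frob_facts:
  shows frob_bij: "bij (frob q s :: 'a \<Rightarrow> 'a)"
    and frob_add: "frob q s ((x :: 'a) + y) = frob q s x + frob q s y"
    and frob_mult: "frob q s ((x :: 'a) * y) = frob q s x * frob q s y"
    and frob_fixes: "(z :: 'a) \<in> GF q \<Longrightarrow> frob q s z = z"
proof -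
  \<comment> \<open>A negative exponent gives the inverse of \<open>\<tau>\<close>, which inherits all properties from \<open>\<tau>\<close>.\<close>
  define \<tau> :: "'a \<Rightarrow> 'a" where "\<tau> = (\<lambda>x. x ^ (q ^ nat \<bar>s\<bar>))"
  have bij: "bij \<tau>"
    unfolding \<tau>_def by (rule frobenius_power_bij)
  have hom: "\<tau> (x + y) = \<tau> x + \<tau> y" "\<tau> (x * y) = \<tau> x * \<tau> y" "z \<in> GF q \<Longrightarrow> \<tau> z = z" for x y z
    by (simp_all add: \<tau>_def frobenius_add power_mult_distrib GF_frobenius_power)
  consider "frob q s = \<tau>" | "frob q s = inv_into UNIV \<tau>"
    by (cases "s \<ge> 0") (auto simp: frob_def \<tau>_def fun_eq_iff)
  then have "bij (frob q s :: 'a \<Rightarrow> 'a) \<and> (\<forall>x y. frob q s ((x :: 'a) + y) = frob q s x + frob q s y) \<and>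
      (\<forall>x y. frob q s ((x :: 'a) * y) = frob q s x * frob q s y) \<and>
      (\<forall>z \<in> GF q. frob q s (z :: 'a) = z)"
  proof cases
    case 1
    then show ?thesis
      using bij hom by simp
  next
    case 2
    have "\<tau> (inv_into UNIV \<tau> x) = x" "inv_into UNIV \<tau> (\<tau> x) = x" for x
      using bij by (simp_all add: bij_is_surj surj_f_inv_f bij_is_inj inv_f_f)
    then have "inv_into UNIV \<tau> (x + y) = inv_into UNIV \<tau> x + inv_into UNIV \<tau> y" "inv_into UNIV \<tau> (x * y) = inv_into UNIV \<tau> x * inv_into UNIV \<tau> y"
      "z \<in> GF q \<Longrightarrow> inv_into UNIV \<tau> z = z" for x y z
      by (metis hom)+
    then show ?thesis
      using 2 bij_imp_bij_inv[OF bij] by simp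
  qed
  then show "bij (frob q s :: 'a \<Rightarrow> 'a)"
    "frob q s ((x :: 'a) + y) = frob q s x + frob q s y"
    "frob q s ((x :: 'a) * y) = frob q s x * frob q s y"
    "(z :: 'a) \<in> GF q \<Longrightarrow> frob q s z = z"
    by auto
qed

lemma frob_zero: "frob q s (0 :: 'a) = 0"
  using frob_add[of s 0 0] by (metis add_0 add_cancel_right_right)

lemma frob_one: "frob q s (1 :: 'a) = 1"
  by (simp add: frob_fixes GF_one)

lemma frob_diff: "frob q s ((x :: 'a) - y) = frob q s x - frob q s y"
  using frob_add[of s "x - y" y] by simp

lemma frob_power: "frob q s ((x :: 'a) ^ k) = frob q s x ^ k"
  by (induction k) (simp_all add: frob_one frob_mult)

lemma frob_prod: "frob q s (prod f A) = (\<Prod>i\<in>A. frob q s (f i :: 'a))"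
  by (induction A rule: infinite_finite_induct) (simp_all add: frob_one frob_mult)

lemma frob_GF: "(x :: 'a) \<in> GF k \<Longrightarrow> frob q s x \<in> GF k"
  by (simp add: GF_def flip: frob_power)

lemma frob_image_GF: "frob q s ` GF k = (GF k :: 'a set)"
proof (rule endo_inj_surj)
  show "inj_on (frob q s) (GF k :: 'a set)"
    using frob_bij bij_is_inj inj_on_subset by blast
qed (auto intro: frob_GF)

lemma frob_ring_iso: "frob q s \<in> ring_iso (GF_ring k) (GF_ring k :: 'a ring)"
proof -
  have "bij_betw (frob q s) (GF k) (GF k :: 'a set)"
    using frob_bij[of s] frob_image_GF[of s k]
    by (metis bij_betw_def inj_on_subset subset_UNIV)
  then show ?thesis
    by (auto simp: ring_iso_def GF_ring_def frob_GF frob_add frob_mult frob_one intro!: ring_hom_memI)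
qed

section \<open>The norm\<close>

lemma field_norm_mult: "field_norm q k ((x :: 'a) * y) = field_norm q k x * field_norm q k y"
  by (simp add: field_norm_def power_mult_distrib prod.distrib)

lemma field_norm_eq_0_iff: "field_norm q k (x :: 'a) = 0 \<longleftrightarrow> x = 0 \<and> k > 0"
  using q_gt_1 by (auto simp: field_norm_def)

text \<open>Raising the norm to the power \<open>q\<close> permutes its factors cyclically, since \<open>x ^ (q ^ k) = x\<close>.\<close>
lemma field_norm_in_GF:
  assumes "(x :: 'a) \<in> GF (q ^ k)"
  shows "field_norm q k x \<in> GF q"
proof (cases "x = 0")
  case True
  then show ?thesis
    using q_gt_1 by (cases k) (auto simp: field_norm_def GF_def power_0_left)
next
  case False
  have "field_norm q k x * x = (\<Prod>i<Suc k. x ^ (q ^ i))"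
    using assms by (simp add: field_norm_def GF_def)
  also have "\<dots> = x * (\<Prod>i<k. x ^ (q ^ Suc i))"
    by (subst prod.lessThan_Suc_shift) simp
  also have "(\<Prod>i<k. x ^ (q ^ Suc i)) = field_norm q k x ^ q"
    by (simp add: field_norm_def prod_power_distrib mult.commute flip: power_mult)
  finally show ?thesis
    using False by (simp add: GF_def)
qed

text \<open>
  The factors of the norm of \<open>x\<close> repeat with period \<open>k\<close>, so over twice as many factors it is a square.
\<close>
lemma field_norm_double:
  assumes "(x :: 'a) \<in> GF (q ^ k)"
  shows "field_norm q (2 * k) x = field_norm q k x ^ 2"
proof -
  have "(\<Prod>i<k + j. x ^ (q ^ i)) = (\<Prod>i<k. x ^ (q ^ i)) * (\<Prod>i<j. x ^ (q ^ i))" for j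
  proof (induction j)
    case (Suc j)
    have "x ^ (q ^ (k + j)) = x ^ (q ^ j)"
      using assms by (simp add: GF_def power_add power_mult)
    with Suc show ?case
      by simp
  qed simp
  from this[of k] show ?thesis
    by (simp add: field_norm_def power2_eq_square mult_2)
qed

text \<open>
  As \<open>frob q s\<close> commutes with powers, the norm of \<open>frob q s x\<close> is the image of the norm of \<open>x\<close>, which is
  fixed because it lies in the field of order \<open>q\<close>.  This treats both signs of \<open>s\<close> alike.
\<close>
lemma field_norm_frob: "field_norm q m (frob q s (x :: 'a)) = field_norm q m x"
proof -
  have "x \<in> GF (q ^ m)"
    using power_card_eq_same[of x] by (simp add: GF_def card_field)
  then have "frob q s (field_norm q m x) = field_norm q m x"
    by (intro frob_fixes field_norm_in_GF)
  then show ?thesis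
    by (simp add: field_norm_def frob_prod frob_power)
qed

end


lemma ex1_bij_betw:
  assumes "bij_betw f A B" and "b \<in> B"
  shows "\<exists>!a. a \<in> A \<and> f a = b"
  using assms unfolding bij_betw_def by (blast dest: inj_onD)

section \<open>The twisted maps\<close>

locale nonsquare_twist = primepow_field q "2 * n" "TYPE('a)"
  for q n :: nat and \<gamma> :: "'a :: {field, finite}" +
  fixes s :: int
  assumes n_pos: "n > 0"
    and nonsquare: "\<not> (\<exists>y \<in> GF q. field_norm q (2 * n) \<gamma> = y ^ 2)"
begin

abbreviation F :: "'a set" where "F \<equiv> GF (q ^ n)"

abbreviation \<sigma> :: "'a \<Rightarrow> 'a" where "\<sigma> \<equiv> frob q s"

abbreviation twist :: "'a \<times> 'a \<Rightarrow> 'a \<Rightarrow> 'a" where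
  "twist p x \<equiv> fst p * x + \<gamma> * snd p * \<sigma> x"

abbreviation coord :: "'a \<times> 'a \<Rightarrow> 'a" where
  "coord p \<equiv> fst p + snd p * \<gamma>"

lemmas F_closed = GF_zero[of n] GF_one[of "q ^ n"] GF_add[of _ n] GF_diff[of _ n] GF_uminus[of _ n]
  GF_mult[of _ "q ^ n"] GF_inverse[of _ "q ^ n"] frob_GF[of _ "q ^ n" s]

lemma norm_neq:
  assumes "y \<in> F"
  shows "field_norm q (2 * n) \<gamma> \<noteq> field_norm q (2 * n) y"
  using nonsquare field_norm_double[OF assms] field_norm_in_GF[OF assms] by auto

lemma gamma_notin: "\<gamma> \<notin> F"
  using norm_neq by blast

text \<open>
  The core of the proof: a nontrivial zero would express \<open>\<gamma>\<close> as \<open>y x / \<sigma> x\<close> with \<open>y \<in> F\<close>, and such an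
  element has the norm of \<open>y\<close>.
\<close>
lemma twist_eq_0_iff:
  assumes "p \<in> F \<times> F"
  shows "twist p x = 0 \<longleftrightarrow> p = 0 \<or> x = 0"
proof
  assume eq: "twist p x = 0"
  obtain a b where p: "p = (a, b)" "a \<in> F" "b \<in> F"
    using assms by auto
  show "p = 0 \<or> x = 0"
  proof (rule disjCI)
    assume x: "x \<noteq> 0"
    have "b = 0"
    proof (rule ccontr)
      assume b: "b \<noteq> 0"
      define y where "y = - (a * inverse b)"
      have "y \<in> F"
        using p by (simp add: y_def F_closed)
      have "\<gamma> * \<sigma> x = y * x"
        using eq b by (simp add: p y_def field_simps add_eq_0_iff)
      then have "field_norm q (2 * n) \<gamma> * field_norm q (2 * n) x
          = field_norm q (2 * n) y * field_norm q (2 * n) x"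
        by (metis field_norm_mult field_norm_frob)
      then show False
        using norm_neq[OF \<open>y \<in> F\<close>] x by (simp add: field_norm_eq_0_iff)
    qed
    then show "p = 0"
      using eq x by (simp add: p zero_prod_def)
  qed
qed (auto simp: frob_zero)

lemma twist_diff: "twist p x - twist p' x = twist (p - p') x"
  by (simp add: algebra_simps)

lemma twist_diff_arg: "twist p x - twist p y = twist p (x - y)"
  by (simp add: frob_diff algebra_simps)

lemma F_pair_diff: "p \<in> F \<times> F \<Longrightarrow> p' \<in> F \<times> F \<Longrightarrow> p - p' \<in> F \<times> F"
  by (auto simp: F_closed)

lemma card_F: "card F = q ^ n"
  using card_GF[of q n 2, where ?'a = 'a] card_field n_pos q_gt_1 by (simp add: mult.commute)

lemma card_F_pairs: "card (F \<times> F) = card (UNIV :: 'a set)"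
  by (simp add: card_cartesian_product card_F card_field mult_2 power_add)

lemma bij_betw_F_pairs:
  assumes "inj_on (f :: 'a \<times> 'a \<Rightarrow> 'a) (F \<times> F)"
  shows "bij_betw f (F \<times> F) UNIV"
  unfolding bij_betw_def using assms card_image[OF assms] card_F_pairs
  by (metis card_subset_eq finite subset_UNIV)

text \<open>\<open>1\<close> and \<open>\<gamma>\<close> are independent over \<open>F\<close>; that they span the field follows by counting.\<close>
lemma coord_bij: "bij_betw coord (F \<times> F) UNIV"
proof (rule bij_betw_F_pairs, rule inj_onI)
  fix p p' assume p: "p \<in> F \<times> F" "p' \<in> F \<times> F" and eq: "coord p = coord p'"
  let ?c = "fst p - fst p'" and ?d = "snd p' - snd p"
  have F: "?c \<in> F" "?d \<in> F"
    using p by (auto simp: F_closed)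
  have eq': "?c = ?d * \<gamma>"
    using eq by (simp add: algebra_simps)
  have "?d = 0"
  proof (rule ccontr)
    assume "?d \<noteq> 0"
    then have "\<gamma> = ?c * inverse ?d"
      unfolding eq' by (simp add: field_simps)
    then show False
      using gamma_notin F by (metis GF_mult GF_inverse)
  qed
  with eq' show "p = p'"
    by (simp add: prod_eq_iff)
qed

lemma twist_bij:
  assumes "p \<in> F \<times> F" and "p \<noteq> 0"
  shows "bij (twist p)"
proof -
  have "inj (twist p)"
    using twist_eq_0_iff[OF assms(1)] assms(2) twist_diff_arg
    by (intro injI) (metis eq_iff_diff_eq_0)
  then show ?thesis
    by (simp add: bij_def finite_UNIV_inj_surj)
qed

text \<open>
  The companion of \<open>twist_bij\<close>, with the roles of the two arguments exchanged: solving for the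
  coefficients is left division in the semifield, solving for \<open>x\<close> is right division.
\<close>
lemma twist_bij_coeffs:
  assumes "x \<noteq> 0"
  shows "bij_betw (\<lambda>p. twist p x) (F \<times> F) UNIV"
proof (rule bij_betw_F_pairs, rule inj_onI)
  fix p p' assume p: "p \<in> F \<times> F" "p' \<in> F \<times> F" and "twist p x = twist p' x"
  then have "twist (p - p') x = 0"
    using twist_diff by (metis eq_iff_diff_eq_0)
  then show "p = p'"
    using twist_eq_0_iff[OF F_pair_diff[OF p]] assms by simp
qed

section \<open>The code\<close>

lemma twisted_code_eq: "twisted_code q n s \<gamma> = twist ` (F \<times> F)"
  by (auto simp: twisted_code_def image_def)

text \<open>A codeword is already determined by its value at \<open>1\<close>.\<close>
lemma twist_bij_code: "bij_betw twist (F \<times> F) (twisted_code q n s \<gamma>)"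
proof -
  have "inj_on ((\<lambda>f. f 1) \<circ> twist) (F \<times> F)"
    using twist_bij_coeffs[of 1] by (simp add: bij_betw_def comp_def)
  then have "inj_on twist (F \<times> F)"
    by (rule inj_on_imageI2)
  then show ?thesis
    by (simp add: bij_betw_def twisted_code_eq)
qed

lemma gf_rank_diff:
  assumes "f \<in> twisted_code q n s \<gamma>" "g \<in> twisted_code q n s \<gamma>" "f \<noteq> g"
  shows "gf_rank q (\<lambda>x. f x - g x) = 2 * n"
proof -
  obtain p p' where p: "p \<in> F \<times> F" "p' \<in> F \<times> F" "f = twist p" "g = twist p'"
    using assms unfolding twisted_code_eq by blast
  have "(\<lambda>x. f x - g x) = twist (p - p')"
    unfolding p by (rule ext) (rule twist_diff)
  moreover have "surj (twist (p - p'))"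
    using twist_bij[OF F_pair_diff[OF p(1,2)]] assms(3) p by (auto simp: bij_def)
  ultimately show ?thesis
    using gf_rank_surj[OF primepow card_field] n_pos by simp
qed

lemma mrd_twisted_code: "mrd_code q (2 * n) (2 * n) (twisted_code q n s \<gamma>)"
proof -
  let ?C = "twisted_code q n s \<gamma>"
  have linear: "gf_linear q f" if "f \<in> ?C" for f
    using that unfolding twisted_code_def gf_linear_def
    by (auto simp: frob_add frob_mult frob_fixes ring_distribs mult_ac add_ac)
  have "twist (0, 0) \<in> ?C" "twist (1, 0) \<in> ?C"
    unfolding twisted_code_eq by (rule imageI, simp add: F_closed)+
  moreover have "twist (0, 0) \<noteq> twist (1, 0)"
    by (auto dest: fun_cong[of _ _ 1])
  ultimately have ex: "\<exists>f \<in> ?C. \<exists>g \<in> ?C. f \<noteq> g"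
    by blast
  have "{gf_rank q (\<lambda>x. f x - g x) | f g. f \<in> ?C \<and> g \<in> ?C \<and> f \<noteq> g} = {2 * n}"
  proof (intro equalityI subsetI)
    fix r assume "r \<in> {2 * n}"
    moreover obtain f g where "f \<in> ?C" "g \<in> ?C" "f \<noteq> g"
      using ex by blast
    ultimately show "r \<in> {gf_rank q (\<lambda>x. f x - g x) | f g. f \<in> ?C \<and> g \<in> ?C \<and> f \<noteq> g}"
      using gf_rank_diff by (intro CollectI exI[of _ f] exI[of _ g]) simp
  qed (auto simp: gf_rank_diff)
  then have "min_rank_distance q ?C = 2 * n"
    by (simp add: min_rank_distance_def)
  moreover have "card ?C = q ^ (2 * n)"
    using bij_betw_same_card[OF twist_bij_code] card_F_pairs card_field by simp
  ultimately show ?thesis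
    using linear ex by (simp add: mrd_code_def)
qed

end

section \<open>The semifield\<close>

text \<open>Multiplication need not be associative; the record type serves only to bundle the operations.\<close>
definition twisted_product_ring :: "('a :: field) set \<Rightarrow> ('a \<Rightarrow> 'a) \<Rightarrow> 'a \<Rightarrow> 'a \<Rightarrow> ('a \<times> 'a) ring" where
  "twisted_product_ring K \<sigma> u v =
     \<lparr>carrier = K \<times> K,
      mult = (\<lambda>(c, d) (a, b). (a * c + b * \<sigma> d * u, a * d + b * \<sigma> c + b * \<sigma> d * v)),
      one = (1, 0),
      zero = (0, 0),
      add = (\<lambda>(c, d) (a, b). (c + a, d + b))\<rparr>"

locale nonsquare_twist_coords = nonsquare_twist q n \<gamma> s
  for q n :: nat and \<gamma> :: "'a :: {field, finite}" and s :: int +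
  fixes u v :: 'a
  assumes u: "u \<in> F" and v: "v \<in> F" and uv: "\<sigma> \<gamma> * \<gamma> = u + v * \<gamma>"
begin

abbreviation S :: "('a \<times> 'a) ring" where
  "S \<equiv> twisted_product_ring F \<sigma> u v"

lemma S_simps [simp]:
  "carrier S = F \<times> F"
  "\<one>\<^bsub>S\<^esub> = (1, 0)"
  "\<zero>\<^bsub>S\<^esub> = 0"
  "x \<oplus>\<^bsub>S\<^esub> y = x + y"
  by (auto simp: twisted_product_ring_def zero_prod_def plus_prod_def split: prod.splits)

lemma mult_S:
  "(c, d) \<otimes>\<^bsub>S\<^esub> (a, b) = (a * c + b * \<sigma> d * u, a * d + b * \<sigma> c + b * \<sigma> d * v)"
  by (simp add: twisted_product_ring_def)

lemma twist_coords:
  "a * (c + d * \<gamma>) + \<gamma> * b * \<sigma> (c + d * \<gamma>) =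
     (a * c + b * \<sigma> d * u) + (a * d + b * \<sigma> c + b * \<sigma> d * v) * \<gamma>"
proof -
  have "\<gamma> * b * \<sigma> (c + d * \<gamma>) = b * \<sigma> c * \<gamma> + b * \<sigma> d * (\<sigma> \<gamma> * \<gamma>)"
    by (simp add: frob_add frob_mult algebra_simps)
  then show ?thesis
    unfolding uv by (simp add: algebra_simps)
qed

text \<open>
  Through \<open>coord\<close>, right multiplication by \<open>y\<close> is the codeword with coefficients \<open>y\<close>.  All division
  properties of \<open>S\<close> are transported from the code by this identity.
\<close>
lemma coord_mult: "coord (x \<otimes>\<^bsub>S\<^esub> y) = twist y (coord x)"
  by (cases x; cases y) (simp add: mult_S twist_coords)

lemma mult_closed_S: "x \<in> F \<times> F \<Longrightarrow> y \<in> F \<times> F \<Longrightarrow> x \<otimes>\<^bsub>S\<^esub> y \<in> F \<times> F"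
  by (cases x; cases y) (simp add: mult_S F_closed u v)

lemma coord_eq_iff: "x \<in> F \<times> F \<Longrightarrow> y \<in> F \<times> F \<Longrightarrow> coord x = coord y \<longleftrightarrow> x = y"
  using coord_bij by (auto simp: bij_betw_def dest: inj_onD)

lemma semifield_S: "semifield S"
proof -
  have "abelian_group S"
  proof (rule abelian_groupI)
    fix x assume "x \<in> carrier S"
    then show "\<exists>y \<in> carrier S. y \<oplus>\<^bsub>S\<^esub> x = \<zero>\<^bsub>S\<^esub>"
      by (intro bexI[of _ "- x"]) (auto simp: F_closed)
  qed (auto simp: F_closed add_ac zero_prod_def)
  moreover have "semifield_axioms S"
  proof
    fix a b assume a: "a \<in> carrier S" "a \<noteq> \<zero>\<^bsub>S\<^esub>" and b: "b \<in> carrier S"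
    have zero: "coord 0 = 0" "0 \<in> F \<times> F"
      by (simp_all add: zero_prod_def F_closed)
    have "coord a \<noteq> 0"
      using coord_eq_iff[of a 0] a zero by simp
    then have "\<exists>!y. y \<in> F \<times> F \<and> twist y (coord a) = coord b"
      by (rule ex1_bij_betw[OF twist_bij_coeffs]) simp
    moreover have "y \<in> F \<times> F \<and> a \<otimes>\<^bsub>S\<^esub> y = b \<longleftrightarrow> y \<in> F \<times> F \<and> twist y (coord a) = coord b" for y
      using coord_eq_iff[of "a \<otimes>\<^bsub>S\<^esub> y" b] coord_mult[of a y] mult_closed_S[of a y] a b by auto
    ultimately show "\<exists>!y. y \<in> carrier S \<and> a \<otimes>\<^bsub>S\<^esub> y = b"
      by simp
    have "bij_betw (twist a \<circ> coord) (F \<times> F) UNIV"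
      using a by (intro bij_betw_trans[OF coord_bij] twist_bij) auto
    then have "\<exists>!x. x \<in> F \<times> F \<and> (twist a \<circ> coord) x = coord b"
      by (rule ex1_bij_betw) simp
    moreover have "x \<in> F \<times> F \<and> x \<otimes>\<^bsub>S\<^esub> a = b \<longleftrightarrow> x \<in> F \<times> F \<and> (twist a \<circ> coord) x = coord b" for x
      using coord_eq_iff[of "x \<otimes>\<^bsub>S\<^esub> a" b] coord_mult[of x a] mult_closed_S[of x a] a b by auto
    ultimately show "\<exists>!x. x \<in> carrier S \<and> x \<otimes>\<^bsub>S\<^esub> a = b"
      by simp
  next
    fix x y z
    show "x \<in> carrier S \<Longrightarrow> y \<in> carrier S \<Longrightarrow> x \<otimes>\<^bsub>S\<^esub> y \<in> carrier S"
      using mult_closed_S by simp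
    show "\<one>\<^bsub>S\<^esub> \<otimes>\<^bsub>S\<^esub> x = x" "x \<otimes>\<^bsub>S\<^esub> \<one>\<^bsub>S\<^esub> = x"
      by (cases x; simp add: mult_S frob_one frob_zero)+
    show "(x \<oplus>\<^bsub>S\<^esub> y) \<otimes>\<^bsub>S\<^esub> z = x \<otimes>\<^bsub>S\<^esub> z \<oplus>\<^bsub>S\<^esub> y \<otimes>\<^bsub>S\<^esub> z"
      "z \<otimes>\<^bsub>S\<^esub> (x \<oplus>\<^bsub>S\<^esub> y) = z \<otimes>\<^bsub>S\<^esub> x \<oplus>\<^bsub>S\<^esub> z \<otimes>\<^bsub>S\<^esub> y"
      by (cases x; cases y; cases z; simp add: mult_S frob_add algebra_simps)+
  qed (auto simp: F_closed zero_prod_def)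
  ultimately show ?thesis
    by (rule semifield.intro)
qed

text \<open>
  By \<open>\<sigma> \<gamma> \<gamma> = u + v \<gamma>\<close>, a root \<open>w\<close> is exactly what makes \<open>\<gamma> \<sigma> (w + \<gamma>)\<close> the multiple of \<open>w + \<gamma>\<close> by
  \<open>v + \<sigma> w \<in> F\<close>.
\<close>
lemma no_root:
  assumes "w \<in> F"
  shows "\<sigma> w * w + v * w - u \<noteq> 0"
proof
  assume "\<sigma> w * w + v * w - u = 0"
  then have "u = (v + \<sigma> w) * w"
    by (simp add: algebra_simps)
  then have "twist (- (v + \<sigma> w), 1) (coord (w, 1)) = 0"
    using uv by (simp add: frob_add algebra_simps)
  moreover have "(- (v + \<sigma> w), 1) \<in> F \<times> F"
    using assms v by (simp add: F_closed)
  ultimately have "coord (w, 1) = 0"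
    using twist_eq_0_iff by (fastforce simp: zero_prod_def)
  then have "\<gamma> = - w"
    by (simp add: eq_neg_iff_add_eq_0 add.commute)
  then show False
    using gamma_notin assms F_closed by metis
qed

lemma hughes_kleinfeld_S: "hughes_kleinfeld (GF_ring (q ^ n)) \<sigma> u v S"
proof -
  interpret R: field "GF_ring (q ^ n) :: 'a ring"
    by (rule field_GF_ring)
  have simps: "carrier (GF_ring (q ^ n)) = F" "x \<otimes>\<^bsub>GF_ring (q ^ n)\<^esub> y = x * y"
    "\<one>\<^bsub>GF_ring (q ^ n)\<^esub> = 1" "\<zero>\<^bsub>GF_ring (q ^ n)\<^esub> = 0" "x \<oplus>\<^bsub>GF_ring (q ^ n)\<^esub> y = x + y"
    for x y :: 'a
    by (simp_all add: GF_ring_def)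
  have minus: "x \<ominus>\<^bsub>GF_ring (q ^ n)\<^esub> y = x - y" if "y \<in> F" for x y :: 'a
    using that R.minus_equality[of "- y" y] by (simp add: a_minus_def simps F_closed)
  show ?thesis
    by unfold_locales
      (use no_root frob_ring_iso u v in \<open>auto simp: simps minus mult_S zero_prod_def\<close>)
qed

lemma corresponds_S: "corresponds_to_code S (twisted_code q n s \<gamma>)"
  unfolding corresponds_to_code_def
proof (intro exI conjI ballI allI)
  show "bij_betw coord (carrier S) UNIV"
    using coord_bij by simp
  show "bij_betw twist (carrier S) (twisted_code q n s \<gamma>)"
    using twist_bij_code by simp
next
  fix x y z
  show "coord (x \<oplus>\<^bsub>S\<^esub> y) = coord x + coord y" "twist (x \<oplus>\<^bsub>S\<^esub> y) z = twist x z + twist y z"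
    by (simp_all add: algebra_simps)
  show "coord (x \<otimes>\<^bsub>S\<^esub> y) = twist y (coord x)"
    by (rule coord_mult)
qed

end

theorem mainTheorem7:
  fixes q n :: nat and s :: int and \<gamma> :: "'a :: {field, finite}"
  assumes "primepow q" and "n > 0" and "card (UNIV :: 'a set) = q ^ (2 * n)"
    and "gcd s (2 * int n) = 1"
    and "\<not> (\<exists>y \<in> GF q. field_norm q (2 * n) \<gamma> = y ^ 2)"
  shows "\<gamma> \<notin> GF (q ^ n) \<and>
    (\<forall>x. \<exists>!p. p \<in> GF (q ^ n) \<times> GF (q ^ n) \<and> x = fst p + snd p * \<gamma>) \<and>
    (\<exists>u \<in> GF (q ^ n). \<exists>v \<in> GF (q ^ n). frob q s \<gamma> * \<gamma> = u + v * \<gamma>) \<and>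
    mrd_code q (2 * n) (2 * n) (twisted_code q n s \<gamma>) \<and>
    (\<forall>u \<in> GF (q ^ n). \<forall>v \<in> GF (q ^ n). frob q s \<gamma> * \<gamma> = u + v * \<gamma> \<longrightarrow>
      (\<forall>a \<in> GF (q ^ n). \<forall>b \<in> GF (q ^ n). \<forall>c \<in> GF (q ^ n). \<forall>d \<in> GF (q ^ n). \<forall>x.
         x = c + d * \<gamma> \<longrightarrow>
         a * x + \<gamma> * b * frob q s x =
           (a * c + b * frob q s d * u) + (a * d + b * frob q s c + b * frob q s d * v) * \<gamma>) \<and>
      (let S = \<lparr>carrier = GF (q ^ n) \<times> GF (q ^ n),
                mult = (\<lambda>(c, d) (a, b).
                  (a * c + b * frob q s d * u, a * d + b * frob q s c + b * frob q s d * v)),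
                one = (1, 0),
                zero = (0, 0),
                add = (\<lambda>(c, d) (a, b). (c + a, d + b))\<rparr>
       in semifield S \<and>
          hughes_kleinfeld (GF_ring (q ^ n)) (frob q s) u v S \<and>
          corresponds_to_code S (twisted_code q n s \<gamma>)))"
proof -
  interpret nonsquare_twist q n \<gamma> s
    by unfold_locales (use assms in auto)
  have coords: "\<exists>!p. p \<in> F \<times> F \<and> x = coord p" for x
    using ex1_bij_betw[OF coord_bij, of x] by (simp add: eq_commute[of x])
  then obtain p where "p \<in> F \<times> F" "\<sigma> \<gamma> * \<gamma> = coord p"
    by metis
  then have ex_uv: "\<exists>u \<in> F. \<exists>v \<in> F. \<sigma> \<gamma> * \<gamma> = u + v * \<gamma>"
    by (intro bexI[of _ "fst p"] bexI[of _ "snd p"]) auto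
  have semifield:
    "(\<forall>a \<in> F. \<forall>b \<in> F. \<forall>c \<in> F. \<forall>d \<in> F. \<forall>x. x = c + d * \<gamma> \<longrightarrow>
        a * x + \<gamma> * b * \<sigma> x = (a * c + b * \<sigma> d * u) + (a * d + b * \<sigma> c + b * \<sigma> d * v) * \<gamma>) \<and>
      (let S = twisted_product_ring F \<sigma> u v
       in semifield S \<and> hughes_kleinfeld (GF_ring (q ^ n)) \<sigma> u v S \<and>
          corresponds_to_code S (twisted_code q n s \<gamma>))"
    if "u \<in> F" "v \<in> F" "\<sigma> \<gamma> * \<gamma> = u + v * \<gamma>" for u v
  proof -
    interpret nonsquare_twist_coords q n \<gamma> s u v
      by unfold_locales (use that in auto)
    show ?thesis
      using twist_coords semifield_S hughes_kleinfeld_S corresponds_S by (simp add: Let_def)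
  qed
  show ?thesis
    by (intro conjI allI ballI impI gamma_notin coords ex_uv mrd_twisted_code
        semifield[unfolded twisted_product_ring_def])
qed

end
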